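(* Let $i \geqslant 1$, and let $1 \leqslant s \leqslant q-1$. Then for any integers $\mu_1, \dots, \mu_s \geqslant 0$ and any integers $0 \leqslant j_1, \dots, j_s \leqslant i$, $$ \sum_{a \in A_{i+}} \frac{\partial_{\theta}^{j_1}(a)^{q^{\mu_1}} \cdots \partial_{\theta}^{j_s}(a)^{q^{\mu_s}}}{a} = \frac{1}{L_i} \prod_{r=1}^s (-1)^{i-j_r}\, e_{i,i-j_r}\bigl( \theta - \theta^{q^{\mu_r}},\, \theta^q - \theta^{q^{\mu_r}},\, \dots,\, \theta^{q^{i-1}} - \theta^{q^{\mu_r}} \bigr) $$ in $K$.
   Context: Let $q$ be a power of a prime, $A = \mathbb{F}_q[\theta]$ the polynomial ring in one variable over the finite field with $q$ elements, and $K = \mathbb{F}_q(\theta)$. For $i\geqslant 0$, $A_{i+}$ is the (finite) set of monic polynomials in $A$ of degree $i$. For $j \geqslant 0$, the hyperderivative $\partial_\theta^j : A \to A$ is the $\mathbb{F}_q$-linear map with $\partial_\theta^j(\theta^n) = \binom{n}{j}\theta^{n-j}$ (which is $0$ when $n<j$); $\partial_\theta^j(a)^{k}$ denotes the $k$-th power of $\partial_\theta^j(a)$. For $i \geqslant 1$, $L_i = (\theta-\theta^q)(\theta - \theta^{q^2})\cdots(\theta-\theta^{q^i}) \in A$. The symbol $e_{ij}=e_{i,j}$ denotes the elementary symmetric polynomial of degree $j$ in $i$ variables, defined by $\sum_{j=0}^i e_{ij}(x_1,\dots,x_i)t^j = (1+x_1t)\cdots(1+x_it)$. *)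

theory Defs
  imports
    "HOL-Computational_Algebra.Computational_Algebra"
    "HOL-Library.Cardinality"
begin

text \<open>
  The field \<open>\<bbbF>\<^sub>q\<close> is a type \<open>'a\<close> of sort \<open>{field, finite}\<close> with \<open>q = CARD('a)\<close>; then
  \<open>A = \<bbbF>\<^sub>q[\<theta>]\<close> is \<^typ>\<open>'a poly\<close> and \<open>K = \<bbbF>\<^sub>q(\<theta>)\<close> is \<^typ>\<open>'a poly fract\<close>.
\<close>

abbreviation theta :: "'a::comm_semiring_1 poly" (\<open>\<theta>\<close>)
  where "\<theta> \<equiv> monom 1 1"

definition monic_polys :: "nat \<Rightarrow> 'a::comm_semiring_1 poly set"
  where "monic_polys i = {a. degree a = i \<and> lead_coeff a = 1}"

text \<open>
  The truncated exponent \<open>n - j\<close> is harmless: for \<open>n < j\<close> the binomial coefficient vanishes.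
\<close>
definition hyperderiv :: "nat \<Rightarrow> 'a::comm_semiring_1 poly \<Rightarrow> 'a poly"
  where "hyperderiv j a = (\<Sum>n\<le>degree a. monom (of_nat (n choose j) * coeff a n) (n - j))"

definition carlitz_L :: "nat \<Rightarrow> nat \<Rightarrow> 'a::comm_ring_1 poly"
  where "carlitz_L q i = (\<Prod>k=1..i. \<theta> - \<theta> ^ (q ^ k))"

text \<open>
  The value of \<open>e\<^sub>i\<^sub>j\<close> at \<open>(x 0, \<dots>, x (i - 1))\<close>: the coefficient of \<open>t\<^sup>j\<close> in
  \<open>(1 + x 0 t) \<cdots> (1 + x (i - 1) t)\<close>. The variables are indexed from \<open>0\<close>.
\<close>
definition elem_sym :: "nat \<Rightarrow> nat \<Rightarrow> (nat \<Rightarrow> 'b::comm_semiring_1) \<Rightarrow> 'b"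
  where "elem_sym i j x = coeff (\<Prod>k<i. [:1, x k:]) j"

lemma finite_monic_polys: "finite (monic_polys i :: 'a::{field, finite} poly set)"
proof -
  have "p \<in> Poly ` {xs. set xs \<subseteq> UNIV \<and> length xs = Suc i}" if "degree p = i" for p :: "'a poly"
  proof
    show "p = Poly (map (coeff p) [0..<Suc i])"
      using that
      by (intro poly_eqI)
         (auto simp: nth_default_def coeff_eq_0 simp del: upt_Suc)
  qed auto
  then have "(monic_polys i :: 'a poly set) \<subseteq> Poly ` {xs. set xs \<subseteq> UNIV \<and> length xs = Suc i}"
    by (auto simp: monic_polys_def)
  then show ?thesis
    by (rule finite_subset) (intro finite_imageI finite_lists_length_eq finite)
qed

lemma hyperderiv_eq_sum:
  assumes "degree a \<le> N"
  shows "hyperderiv j a = (\<Sum>n\<le>N. monom (of_nat (n choose j) * coeff a n) (n - j))"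
  unfolding hyperderiv_def using assms
  by (intro sum.mono_neutral_left) (auto simp: coeff_eq_0)

lemma hyperderiv_add: "hyperderiv j (a + b) = hyperderiv j a + hyperderiv j b"
proof -
  define N where "N = max (degree a) (degree b)"
  have "degree a \<le> N" "degree b \<le> N" "degree (a + b) \<le> N"
    by (auto simp: N_def intro: degree_add_le)
  then show ?thesis
    by (simp add: hyperderiv_eq_sum sum.distrib [symmetric] add_monom distrib_left)
qed

lemma hyperderiv_smult: "hyperderiv j (smult c a) = smult c (hyperderiv j a)"
proof -
  have "smult c (sum f {..n}) = (\<Sum>m\<le>n. smult c (f m))" for f :: "nat \<Rightarrow> 'a poly" and n
    by (induction n) (simp_all add: smult_add_right)
  then show ?thesis
    by (simp add: hyperderiv_eq_sum [OF degree_smult_le] hyperderiv_def [of j a]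
        smult_monom mult.left_commute)
qed

lemma hyperderiv_theta_power:
  "hyperderiv j (\<theta> ^ n) = monom (of_nat (n choose j)) (n - j)"
proof -
  have "(\<theta> :: 'a poly) ^ n = monom 1 n"
    by (simp add: monom_power)
  moreover have "(\<Sum>m\<le>n. monom (of_nat (m choose j) * coeff (monom (1::'a) n) m) (m - j)) =
      (\<Sum>m\<in>{n}. monom (of_nat (m choose j)) (m - j))"
    by (intro sum.mono_neutral_cong_right) auto
  ultimately show ?thesis
    by (simp add: hyperderiv_eq_sum [where N = n] degree_monom_le)
qed

end

theory Submission
  imports Defs
begin

text \<open>
  Write \<open>q\<close> for the number of constants, \<open>\<theta>\<^sub>k\<close> for \<open>\<theta>\<close> to the power \<open>q\<^sup>k\<close>, and \<open>a(t)\<close> for the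
  polynomial \<open>a\<close> with \<open>\<theta>\<close> replaced by a new variable \<open>t\<close>. As constants are fixed by the \<open>q\<close>-th
  power map, \<open>a(\<theta>\<^sub>k)\<close> is \<open>a\<close> to the power \<open>q\<^sup>k\<close>. For the same reason, the twisted hyperderivative in
  the \<open>r\<close>-th factor of the numerator is the coefficient of \<open>x\<^sup>j\<close>, \<open>j = j\<^sub>r\<close>, in \<open>a(\<theta>\<^sub>\<mu> + x)\<close>,
  \<open>\<mu> = \<mu>\<^sub>r\<close> (\<open>hyperderiv_power_eq_coeff\<close>).

  Lagrange interpolation at the \<open>i\<close> nodes \<open>\<theta>\<^sub>0, \<dots>, \<theta>\<^sub>i\<^sub>-\<^sub>1\<close> determines \<open>a(t)\<close> up to a multiple of
  \<open>B(t) = (t - \<theta>\<^sub>0) \<cdots> (t - \<theta>\<^sub>i\<^sub>-\<^sub>1)\<close>; if \<open>a\<close> is monic of degree \<open>i\<close>, this multiple is \<open>B(t)\<close> itself. So \<open>a(t)\<close> is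
  \<open>B(t)\<close> plus a linear combination, with coefficients that do not depend on \<open>a\<close>, of the powers of
  \<open>a\<close> with exponents \<open>1, q, \<dots>, q\<^sup>i\<^sup>-\<^sup>1\<close>. Shifting by \<open>\<theta>\<^sub>\<mu>\<close> and taking a coefficient, each factor of the
  numerator is such a combination plus a term independent of \<open>a\<close> (\<open>hyperderiv_power_monic\<close>). That term is a
  coefficient of \<open>B(\<theta>\<^sub>\<mu> + x)\<close>, that is, the signed elementary symmetric polynomial in the claim.

  Now expand the product of the \<open>s\<close> factors and divide by \<open>a\<close>. The product of the terms independent of \<open>a\<close>
  contributes the factor \<open>\<Sum> 1 / a\<close>, which is \<open>1 / L\<^sub>i\<close> (\<open>sum_inverse_monic\<close>). Every other term contains at least
  one and at most \<open>q - 1\<close> of the combinations of Frobenius powers. Dividing one of them by \<open>a\<close> leaves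
  powers of \<open>a\<close> with exponent \<open>q\<^sup>k - 1\<close>, \<open>k < i\<close>, and such a power is the product of \<open>k (q - 1)\<close>
  Frobenius powers. Hence the term is a sum of products of at most
  \<open>(i - 1) (q - 1) + (q - 2) < i (q - 1)\<close> maps that are linear over the constants. Summed over the
  \<open>i\<close>-dimensional affine space of monic polynomials of degree \<open>i\<close>, products of so few linear maps
  vanish (\<open>sum_monic_prod_linear_eq_0\<close>), as in the theorem of Chevalley and Warning.
\<close>

section \<open>The Frobenius map\<close>

lemma finite_field_power_CARD: "(c :: 'a::{field, finite}) ^ CARD('a) = c"
proof (cases "c = 0")
  case False
  have "c ^ (CARD('a) - 1) * \<Prod>(UNIV - {0}) = (\<Prod>y\<in>UNIV - {0}. c * y)"
    by (simp add: prod.distrib card_Diff_singleton)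
  also have "\<dots> = \<Prod>(UNIV - {0})"
    by (rule prod.reindex_bij_witness [of _ "\<lambda>y. y / c" "\<lambda>y. c * y"]) (use False in auto)
  finally have "c ^ (CARD('a) - 1) = 1"
    by simp
  moreover have "CARD('a) = Suc (CARD('a) - 1)"
    by simp
  ultimately show ?thesis
    by (metis power_Suc mult.right_neutral)
qed simp

lemma CARD_field_gt_1: "CARD('a::{field, finite}) > 1"
proof -
  have "card {0, 1 :: 'a} \<le> CARD('a)"
    by (rule card_mono) auto
  then show ?thesis
    by simp
qed

text \<open>
  The polynomials \<open>(1 + X)\<^sup>q\<close> and \<open>1 + X\<^sup>q\<close> are monic of degree \<open>q\<close> and agree at all \<open>q\<close> constants, so
  they are equal. In this way the additivity of the \<open>q\<close>-th power map follows without knowing that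
  \<open>q\<close> is a power of the characteristic.
\<close>
lemma of_nat_CARD_choose_eq_0:
  assumes "0 < k" "k < CARD('a::{field, finite})"
  shows "of_nat (CARD('a) choose k) = (0 :: 'a)"
proof -
  let ?q = "CARD('a)"
  have "[:1, 1 :: 'a:] ^ ?q = monom 1 ?q + 1"
  proof (rule poly_eqI_degree_lead_coeff [where n = ?q and A = UNIV])
    show "coeff ([:1, 1 :: 'a:] ^ ?q) ?q = coeff (monom 1 ?q + 1) ?q"
      using assms by (simp add: coeff_linear_power)
    show "degree ([:1, 1 :: 'a:] ^ ?q) \<le> ?q"
      by (simp add: degree_power_eq)
    show "degree (monom 1 ?q + 1 :: 'a poly) \<le> ?q"
      by (intro degree_add_le) (simp_all add: degree_monom_le)
  qed (simp_all add: poly_monom finite_field_power_CARD)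
  then have "coeff ([:1, 1 :: 'a:] ^ ?q) k = coeff (monom 1 ?q + 1) k"
    by simp
  then show ?thesis
    using assms by (simp add: coeff_linear_poly_power)
qed

lemma poly_add_power_CARD:
  fixes a b :: "'a::{field, finite} poly"
  shows "(a + b) ^ CARD('a) = a ^ CARD('a) + b ^ CARD('a)"
proof -
  let ?q = "CARD('a)"
  have "(a + b) ^ ?q = (\<Sum>k\<le>?q. of_nat (?q choose k) * a ^ k * b ^ (?q - k))"
    by (rule binomial_ring)
  also have "\<dots> = (\<Sum>k\<in>{0, ?q}. of_nat (?q choose k) * a ^ k * b ^ (?q - k))"
    by (intro sum.mono_neutral_right) (auto simp: of_nat_poly of_nat_CARD_choose_eq_0)
  also have "\<dots> = a ^ ?q + b ^ ?q"
    by simp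
  finally show ?thesis .
qed

lemma poly_add_power_CARD_power:
  fixes a b :: "'a::{field, finite} poly"
  shows "(a + b) ^ (CARD('a) ^ k) = a ^ (CARD('a) ^ k) + b ^ (CARD('a) ^ k)"
  by (induction k) (simp_all add: power_mult poly_add_power_CARD mult.commute [of "CARD('a)"])

lemma const_power_CARD_power: "[:c :: 'a::{field, finite}:] ^ (CARD('a) ^ k) = [:c:]"
  by (induction k)
     (simp_all add: power_mult poly_const_pow finite_field_power_CARD mult.commute [of "CARD('a)"])

section \<open>Linear maps from polynomials to rational functions\<close>

lemma to_fract_power: "to_fract (x ^ n) = to_fract x ^ n"
  by (induction n) simp_all

lemma to_fract_sum: "to_fract (\<Sum>x\<in>A. f x) = (\<Sum>x\<in>A. to_fract (f x))"
  by (induction A rule: infinite_finite_induct) simp_all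

lemma to_fract_prod: "to_fract (\<Prod>x\<in>A. f x) = (\<Prod>x\<in>A. to_fract (f x))"
  by (induction A rule: infinite_finite_induct) simp_all

definition scalar :: "'a::field \<Rightarrow> 'a poly fract"
  where "scalar c = to_fract [:c:]"

lemma scalar_0 [simp]: "scalar 0 = 0"
  by (simp add: scalar_def)

lemma scalar_1 [simp]: "scalar 1 = 1"
  by (simp add: scalar_def flip: one_pCons)

lemma scalar_add: "scalar (c + d) = scalar c + scalar d"
  by (simp add: scalar_def flip: to_fract_add)

lemma scalar_mult: "scalar (c * d) = scalar c * scalar d"
  by (simp add: scalar_def flip: to_fract_mult)

lemma scalar_of_nat: "scalar (of_nat n) = of_nat n"
  by (induction n) (simp_all add: scalar_add)

lemma scalar_power: "scalar (c ^ m) = scalar c ^ m"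
  by (induction m) (simp_all add: scalar_mult)

lemma scalar_eq_0_iff: "scalar c = 0 \<longleftrightarrow> c = 0"
  by (simp add: scalar_def)

lemma scalar_sum: "scalar (\<Sum>x\<in>A. f x) = (\<Sum>x\<in>A. scalar (f x))"
  by (induction A rule: infinite_finite_induct) (simp_all add: scalar_add)

definition Fq_linear :: "('a::field poly \<Rightarrow> 'a poly fract) \<Rightarrow> bool"
  where "Fq_linear f \<longleftrightarrow>
    (\<forall>a b. f (a + b) = f a + f b) \<and> (\<forall>c a. f (smult c a) = scalar c * f a)"

lemma Fq_linear_add: "Fq_linear f \<Longrightarrow> f (a + b) = f a + f b"
  and Fq_linear_smult: "Fq_linear f \<Longrightarrow> f (smult c a) = scalar c * f a"
  by (simp_all add: Fq_linear_def)

lemma Fq_linear_frobenius: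
  "Fq_linear (\<lambda>a. to_fract a ^ (CARD('a::{field, finite}) ^ k) :: 'a poly fract)"
proof -
  have "smult c a = [:c:] * a" for c and a :: "'a poly"
    by simp
  then show ?thesis
    unfolding Fq_linear_def scalar_def to_fract_power [symmetric] to_fract_add [symmetric]
      to_fract_mult [symmetric] to_fract_eq_iff
    by (metis poly_add_power_CARD_power power_mult_distrib const_power_CARD_power)
qed

lemma Fq_linear_sum_mult:
  assumes "\<And>k. k \<in> S \<Longrightarrow> Fq_linear (f k)"
  shows "Fq_linear (\<lambda>a. \<Sum>k\<in>S. g k * f k a)"
  using assms unfolding Fq_linear_def
  by (simp add: sum.distrib distrib_left sum_distrib_left mult.left_commute cong: sum.cong)

section \<open>Sums of products of few linear maps\<close>

text \<open>
  For \<open>m > 0\<close> the equation \<open>g\<^sup>m = 1\<close> has too few solutions to hold for every \<open>g \<noteq> 0\<close>; substituting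
  \<open>g c\<close> for \<open>c\<close> multiplies the sum by \<open>g\<^sup>m\<close>. For \<open>m = 0\<close> the sum is \<open>q\<close>, as \<open>0\<^sup>0 = 1\<close>.
\<close>
lemma sum_power_eq_0:
  assumes "m < CARD('a::{field, finite}) - 1"
  shows "(\<Sum>c\<in>UNIV. (c :: 'a) ^ m) = 0"
proof (cases "m = 0")
  case True
  have "of_nat (CARD('a)) = (0 :: 'a)"
    using of_nat_CARD_choose_eq_0 [of 1, where 'a = 'a] CARD_field_gt_1 [where 'a = 'a] by simp
  with True show ?thesis
    by simp
next
  case False
  have "\<exists>g. g \<noteq> 0 \<and> (g :: 'a) ^ m \<noteq> 1"
  proof (rule ccontr)
    assume "\<not> ?thesis"
    then have *: "g \<noteq> 0 \<Longrightarrow> (g :: 'a) ^ m = 1" for g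
      by blast
    have "monom (1 :: 'a) m = 1"
      using assms False
      by (intro poly_eqI_degree [where A = "UNIV - {0}"])
         (auto simp: poly_monom * card_Diff_singleton degree_monom_eq)
    then have "degree (monom (1 :: 'a) m) = 0"
      by simp
    with False show False
      by (simp add: degree_monom_eq)
  qed
  then obtain g :: 'a where g: "g \<noteq> 0" "g ^ m \<noteq> 1"
    by blast
  have "(\<Sum>c\<in>UNIV. (c :: 'a) ^ m) = (\<Sum>c\<in>UNIV. (g * c) ^ m)"
    by (rule sum.reindex_bij_witness [of _ "\<lambda>y. g * y" "\<lambda>y. y / g"]) (use g in auto)
  also have "\<dots> = g ^ m * (\<Sum>c\<in>UNIV. c ^ m)"
    by (simp add: power_mult_distrib sum_distrib_left)
  finally show ?thesis
    using g by simp
qed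

text \<open>
  A bound on the degree would have to treat \<open>i = 0\<close> and the zero polynomial separately.
\<close>
definition polys_below :: "nat \<Rightarrow> 'a::zero poly set"
  where "polys_below i = {b. \<forall>n\<ge>i. coeff b n = 0}"

lemma polys_below_0: "polys_below 0 = {0}"
  by (auto simp: polys_below_def poly_eq_iff)

lemma bij_betw_polys_below_Suc:
  "bij_betw (\<lambda>(c, b). smult c (\<theta> ^ i) + b) (UNIV \<times> polys_below i)
     (polys_below (Suc i) :: 'a::field poly set)"
proof (rule bij_betwI [where g = "\<lambda>b. (coeff b i, b - monom (coeff b i) i)"])
qed (auto simp: polys_below_def monom_power smult_monom poly_eq_iff)

lemma bij_betw_monic_polys:
  "bij_betw (\<lambda>b. \<theta> ^ i + b) (polys_below i) (monic_polys i :: 'a::field poly set)"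
proof (rule bij_betwI [where g = "\<lambda>b. b - \<theta> ^ i"])
  show "(\<lambda>b. \<theta> ^ i + b) \<in> polys_below i \<rightarrow> (monic_polys i :: 'a poly set)"
  proof
    fix b :: "'a poly"
    assume b: "b \<in> polys_below i"
    have "degree (\<theta> ^ i + b) = i"
      using b by (intro antisym degree_le le_degree) (auto simp: polys_below_def monom_power)
    then show "\<theta> ^ i + b \<in> monic_polys i"
      using b by (simp add: monic_polys_def polys_below_def monom_power)
  qed
  show "(\<lambda>b. b - \<theta> ^ i) \<in> monic_polys i \<rightarrow> (polys_below i :: 'a poly set)"
    by (auto simp: monic_polys_def polys_below_def monom_power coeff_eq_0)
qed auto

lemma card_polys_below: "card (polys_below i :: 'a::{field, finite} poly set) = CARD('a) ^ i"
proof (induction i)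
  case (Suc i)
  show ?case
    using bij_betw_same_card [OF bij_betw_polys_below_Suc [of i, where 'a = 'a]] Suc
    by (simp add: card_cartesian_product)
qed (simp add: polys_below_0)

lemma card_monic_polys: "card (monic_polys i :: 'a::{field, finite} poly set) = CARD('a) ^ i"
  using bij_betw_same_card [OF bij_betw_monic_polys [of i, where 'a = 'a]] card_polys_below
  by metis

text \<open>
  Split off the top coefficient \<open>c\<close> of \<open>b\<close> and expand the product in powers of \<open>c\<close>. In the term
  where \<open>c\<close> is taken from the factors in \<open>X\<close>, either \<open>X\<close> has fewer than \<open>q - 1\<close> elements and the sum
  over \<open>c\<close> vanishes, or fewer than \<open>(i - 1) (q - 1)\<close> factors are left and the sum over the remaining
  coefficients vanishes by induction. The constants \<open>u r\<close> make the sum over monic polynomials a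
  special case.
\<close>
lemma sum_prod_affine_eq_0:
  fixes f :: "'i \<Rightarrow> 'a::{field, finite} poly \<Rightarrow> 'a poly fract"
  assumes "finite I" and "\<And>r. r \<in> I \<Longrightarrow> Fq_linear (f r)"
    and "card I < i * (CARD('a) - 1)"
  shows "(\<Sum>b\<in>polys_below i. \<Prod>r\<in>I. u r + f r b) = 0"
  using assms
proof (induction i arbitrary: I)
  case (Suc i)
  let ?T = "\<theta> ^ i :: 'a poly"
  have "(\<Sum>b\<in>polys_below (Suc i). \<Prod>r\<in>I. u r + f r b) =
      (\<Sum>(c, b)\<in>UNIV \<times> polys_below i. \<Prod>r\<in>I. u r + f r (smult c ?T + b))"
    by (subst sum.reindex_bij_betw [OF bij_betw_polys_below_Suc, symmetric])
       (simp add: case_prod_beta)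
  also have "\<dots> = (\<Sum>(c, b)\<in>UNIV \<times> polys_below i. \<Prod>r\<in>I. scalar c * f r ?T + (u r + f r b))"
    using Suc.prems(2)
    by (intro sum.cong prod.cong refl) (auto simp: Fq_linear_add Fq_linear_smult intro!: prod.cong)
  also have "\<dots> = (\<Sum>(c, b)\<in>UNIV \<times> polys_below i. \<Sum>X\<in>Pow I.
      scalar (c ^ card X) * ((\<Prod>r\<in>X. f r ?T) * (\<Prod>r\<in>I - X. u r + f r b)))"
    using Suc.prems(1)
    by (simp add: prod_add prod.distrib scalar_power mult.assoc)
  also have "\<dots> = (\<Sum>X\<in>Pow I. \<Sum>(c, b)\<in>UNIV \<times> polys_below i.
      scalar (c ^ card X) * ((\<Prod>r\<in>X. f r ?T) * (\<Prod>r\<in>I - X. u r + f r b)))"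
    unfolding case_prod_beta by (rule sum.swap)
  also have "\<dots> = (\<Sum>X\<in>Pow I. scalar (\<Sum>c\<in>UNIV. c ^ card X) *
      ((\<Prod>r\<in>X. f r ?T) * (\<Sum>b\<in>polys_below i. \<Prod>r\<in>I - X. u r + f r b)))"
    by (simp add: sum.cartesian_product [symmetric] sum_distrib_left [symmetric]
        sum_distrib_right [symmetric] scalar_sum)
  also have "\<dots> = 0"
  proof (intro sum.neutral ballI)
    fix X
    assume X: "X \<in> Pow I"
    show "scalar (\<Sum>c\<in>UNIV. c ^ card X) *
      ((\<Prod>r\<in>X. f r ?T) * (\<Sum>b\<in>polys_below i. \<Prod>r\<in>I - X. u r + f r b)) = 0"
    proof (cases "card X < CARD('a) - 1")
      case True
      then show ?thesis
        by (simp add: sum_power_eq_0)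
    next
      case False
      have "card (I - X) = card I - card X"
        using X Suc.prems(1) by (auto intro: card_Diff_subset finite_subset)
      then have "card (I - X) < i * (CARD('a) - 1)"
        using False Suc.prems(3) X Suc.prems(1) card_mono [of I X] by auto
      then have "(\<Sum>b\<in>polys_below i. \<Prod>r\<in>I - X. u r + f r b) = 0"
        using Suc.prems(1,2) by (intro Suc.IH) auto
      then show ?thesis
        by simp
    qed
  qed
  finally show ?case .
qed simp

lemma sum_monic_prod_linear_eq_0:
  fixes f :: "'i \<Rightarrow> 'a::{field, finite} poly \<Rightarrow> 'a poly fract"
  assumes "finite I" and "\<And>r. r \<in> I \<Longrightarrow> Fq_linear (f r)"
    and "card I < i * (CARD('a) - 1)"
  shows "(\<Sum>a\<in>monic_polys i. \<Prod>r\<in>I. f r a) = 0"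
proof -
  have "(\<Sum>a\<in>monic_polys i. \<Prod>r\<in>I. f r a) =
      (\<Sum>b\<in>polys_below i. \<Prod>r\<in>I. f r (\<theta> ^ i) + f r b)"
    using assms(2)
    by (subst sum.reindex_bij_betw [OF bij_betw_monic_polys, symmetric])
       (auto simp: Fq_linear_add intro!: sum.cong prod.cong)
  then show ?thesis
    using sum_prod_affine_eq_0 [OF assms] by simp
qed

lemma prod_power_CARD_minus_1:
  "(\<Prod>l<k. (x :: 'b::comm_monoid_mult) ^ (q ^ l * (q - 1))) = x ^ (q ^ k - 1)" if "q > 0"
proof (induction k)
  case (Suc k)
  have "q ^ k - 1 + q ^ k * (q - 1) = q ^ Suc k - 1"
    using that by (cases q) (simp_all add: algebra_simps)
  then show ?case
    using Suc by (simp flip: power_add)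
qed simp

text \<open>
  One of the factors absorbs the denominator and leaves powers of \<open>a\<close> with exponent \<open>q\<^sup>k - 1\<close>,
  \<open>k < i\<close>. The base-\<open>q\<close> digits of this exponent are \<open>k\<close> times \<open>q - 1\<close>, so such a power is a product of
  \<open>k (q - 1)\<close> linear maps, and together with the at most \<open>q - 2\<close> other factors there are fewer than
  \<open>i (q - 1)\<close> of them.
\<close>
lemma sum_monic_prod_linearized_div_eq_0:
  fixes g :: "'i \<Rightarrow> nat \<Rightarrow> 'a::{field, finite} poly fract"
  assumes "finite Y" "Y \<noteq> {}" "card Y \<le> CARD('a) - 1"
  shows "(\<Sum>a\<in>monic_polys i.
    (\<Prod>r\<in>Y. \<Sum>k<i. g r k * to_fract a ^ (CARD('a) ^ k)) / to_fract a) = 0"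
proof -
  let ?q = "CARD('a)"
  define F where "F r a = (\<Sum>k<i. g r k * to_fract a ^ (?q ^ k))" for r and a :: "'a poly"
  obtain s where s: "s \<in> Y"
    using assms by blast
  \<comment> \<open>The index set for the linear maps whose product is the \<open>k\<close>-th term: \<open>Inl r\<close> stands for the
     \<open>r\<close>-th remaining factor, \<open>Inr (l, m)\<close> for the \<open>m\<close>-th copy of the \<open>q\<^sup>l\<close>-th power.\<close>
  let ?I = "\<lambda>k. (Y - {s}) <+> ({..<k} \<times> {..<?q - 1})"
  define f where "f = case_sum F (\<lambda>(l :: nat, m :: nat) a. to_fract (a :: 'a poly) ^ (?q ^ l))"
  have nz: "to_fract a \<noteq> 0" if "a \<in> monic_polys i" for a :: "'a poly"
    using that by (auto simp: monic_polys_def)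
  have split: "(\<Prod>r\<in>?I k. f r a) = (\<Prod>r\<in>Y - {s}. F r a) * to_fract a ^ (?q ^ k - 1)" for k a
  proof -
    have "(\<Prod>r\<in>?I k. f r a) = (\<Prod>r\<in>Y - {s}. F r a) *
        (\<Prod>l<k. \<Prod>m<?q - 1. to_fract a ^ (?q ^ l))"
      using assms(1)
      unfolding prod.cartesian_product
      by (subst prod.Plus) (simp_all add: f_def case_prod_beta)
    then show ?thesis
      using prod_power_CARD_minus_1 [of ?q "to_fract a" k] by (simp add: power_mult)
  qed
  have "(\<Prod>r\<in>Y. F r a) / to_fract a = (\<Sum>k<i. g s k * (\<Prod>r\<in>?I k. f r a))"
    if a: "a \<in> monic_polys i" for a
  proof -
    have "to_fract a ^ (?q ^ k) = to_fract a * to_fract a ^ (?q ^ k - 1)" for k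
      by (simp flip: power_Suc)
    then have "F s a = to_fract a * (\<Sum>k<i. g s k * to_fract a ^ (?q ^ k - 1))"
      unfolding F_def by (simp add: sum_distrib_left mult.left_commute)
    moreover have "(\<Prod>r\<in>Y. F r a) = F s a * (\<Prod>r\<in>Y - {s}. F r a)"
      using assms(1) s by (rule prod.remove)
    ultimately have "(\<Prod>r\<in>Y. F r a) / to_fract a =
        (\<Sum>k<i. g s k * to_fract a ^ (?q ^ k - 1)) * (\<Prod>r\<in>Y - {s}. F r a)"
      using nz [OF a] by simp
    also have "\<dots> = (\<Sum>k<i. g s k * (\<Prod>r\<in>?I k. f r a))"
      unfolding split sum_distrib_right by (intro sum.cong refl) (simp add: mult_ac)
    finally show ?thesis .
  qed
  then have "(\<Sum>a\<in>monic_polys i. (\<Prod>r\<in>Y. F r a) / to_fract a) =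
      (\<Sum>a\<in>monic_polys i. \<Sum>k<i. g s k * (\<Prod>r\<in>?I k. f r a))"
    by simp
  also have "\<dots> = (\<Sum>k<i. \<Sum>a\<in>monic_polys i. g s k * (\<Prod>r\<in>?I k. f r a))"
    by (rule sum.swap)
  also have "\<dots> = (\<Sum>k<i. g s k * (\<Sum>a\<in>monic_polys i. \<Prod>r\<in>?I k. f r a))"
    by (simp add: sum_distrib_left)
  also have "\<dots> = 0"
  proof (intro sum.neutral ballI)
    fix k
    assume k: "k \<in> {..<i}"
    have "card (Y - {s}) < ?q - 1"
      using assms s card_gt_0_iff [of Y] by (simp add: card_Diff_singleton)
    then have "card (?I k) < Suc k * (?q - 1)"
      using assms(1) by (simp add: card_Plus card_cartesian_product)
    also have "\<dots> \<le> i * (?q - 1)"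
      using k by (intro mult_le_mono1) auto
    finally have "(\<Sum>a\<in>monic_polys i. \<Prod>r\<in>?I k. f r a) = 0"
      using assms(1)
      by (intro sum_monic_prod_linear_eq_0)
         (auto simp: f_def F_def [abs_def] intro!: Fq_linear_sum_mult Fq_linear_frobenius)
    then show "g s k * (\<Sum>a\<in>monic_polys i. \<Prod>r\<in>?I k. f r a) = 0"
      by simp
  qed
  finally show ?thesis
    by (simp add: F_def)
qed

section \<open>Lagrange interpolation\<close>

definition lagrange_basis :: "'k set \<Rightarrow> ('k \<Rightarrow> 'b::field) \<Rightarrow> 'k \<Rightarrow> 'b poly"
  where "lagrange_basis S x k =
    smult (1 / (\<Prod>l\<in>S - {k}. x k - x l)) (\<Prod>l\<in>S - {k}. [:- x l, 1:])"

lemma degree_prod_linear: "degree (\<Prod>l\<in>S. [:- x l, 1 :: 'b::field:]) = card S"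
  by (subst degree_prod_eq_sum_degree) auto

lemma coeff_prod_linear: "coeff (\<Prod>l\<in>S. [:- x l, 1 :: 'b::field:]) (card S) = 1"
  using lead_coeff_prod [of "\<lambda>l. [:- x l, 1:]" S] by (simp add: degree_prod_linear)

lemma lagrange_interpolation:
  fixes x :: "'k \<Rightarrow> 'b::field"
  assumes "finite S" "inj_on x S" "degree p < card S"
  shows "p = (\<Sum>k\<in>S. smult (poly p (x k)) (lagrange_basis S x k))"
proof (rule poly_eqI_degree [where A = "x ` S"])
  show "degree p < card (x ` S)"
    using assms by (simp add: card_image)
  have "degree (\<Sum>k\<in>S. smult (poly p (x k)) (lagrange_basis S x k)) \<le> card S - 1"
    using assms(1) unfolding lagrange_basis_def
    by (intro degree_sum_le order.trans [OF degree_smult_le])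
       (simp_all add: degree_prod_linear card_Diff_singleton)
  then show "degree (\<Sum>k\<in>S. smult (poly p (x k)) (lagrange_basis S x k)) < card (x ` S)"
    using assms by (simp add: card_image)
  fix z
  assume "z \<in> x ` S"
  then obtain m where m: "m \<in> S" "z = x m"
    by blast
  have "poly (lagrange_basis S x k) (x m) = (if k = m then 1 else 0)" if "k \<in> S" for k
    using assms m that by (auto simp: lagrange_basis_def poly_prod inj_on_eq_iff)
  then show "poly p z = poly (\<Sum>k\<in>S. smult (poly p (x k)) (lagrange_basis S x k)) z"
    using assms m by (simp add: poly_sum if_distrib [where f = "\<lambda>c. _ * c"] cong: if_cong sum.cong)
qed

section \<open>Evaluation at the conjugates of theta\<close>

definition theta_conj :: "nat \<Rightarrow> 'a::{field, finite} poly fract"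
  where "theta_conj k = to_fract (\<theta> ^ (CARD('a) ^ k))"

lemma inj_theta_conj: "inj (theta_conj :: nat \<Rightarrow> 'a::{field, finite} poly fract)"
  using CARD_field_gt_1 [where 'a = 'a]
  by (auto simp: inj_def theta_conj_def monom_power monom_eq_iff')

text \<open>
  The image of \<open>a\<close> under the substitution of a new variable \<open>t\<close> for \<open>\<theta>\<close>, as a polynomial in \<open>t\<close>
  over the rational functions in \<open>\<theta>\<close>.
\<close>
definition lift :: "'a::field poly \<Rightarrow> 'a poly fract poly"
  where "lift a = map_poly scalar a"

lemma coeff_lift: "coeff (lift a) n = scalar (coeff a n)"
  by (simp add: lift_def coeff_map_poly)

lemma degree_lift: "degree (lift a) = degree a"
  by (simp add: lift_def degree_map_poly scalar_eq_0_iff)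

lemma poly_lift_theta_conj:
  fixes a :: "'a::{field, finite} poly"
  shows "poly (lift a) (theta_conj k) = to_fract a ^ (CARD('a) ^ k)"
proof (induction a)
  case (pCons c a)
  have "pCons c a = [:c:] + \<theta> * a"
    by (simp add: monom_altdef)
  then have "pCons c a ^ (CARD('a) ^ k) = [:c:] + \<theta> ^ (CARD('a) ^ k) * a ^ (CARD('a) ^ k)"
    by (simp only: poly_add_power_CARD_power const_power_CARD_power power_mult_distrib)
  then have "to_fract (pCons c a) ^ (CARD('a) ^ k) =
      scalar c + theta_conj k * to_fract a ^ (CARD('a) ^ k)"
    unfolding to_fract_power [symmetric] scalar_def theta_conj_def by simp
  with pCons show ?case
    by (simp add: lift_def map_poly_pCons)
qed (simp add: lift_def)

text \<open>
  Hyperderivatives are Taylor coefficients: \<open>a(t + x)\<close> has the \<open>j\<close>-th hyperderivative of \<open>a\<close> at \<open>t\<close> as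
  its coefficient of \<open>x\<^sup>j\<close>. At a conjugate of \<open>\<theta>\<close> its value is a Frobenius power of the
  hyperderivative.
\<close>
lemma hyperderiv_power_eq_coeff:
  fixes a :: "'a::{field, finite} poly"
  shows "to_fract (hyperderiv j a) ^ (CARD('a) ^ \<mu>) =
    coeff (pcompose (lift a) [:theta_conj \<mu>, 1:]) j"
proof -
  let ?t = "theta_conj \<mu> :: 'a poly fract"
  have lift_sum: "lift (sum h S) = (\<Sum>n\<in>S. lift (h n))" for h :: "nat \<Rightarrow> 'a poly" and S
    by (rule poly_eqI) (simp add: coeff_lift coeff_sum scalar_sum)
  have lift_monom: "lift (monom c n) = monom (scalar c) n" for c :: 'a and n
    by (simp add: lift_def map_poly_monom)
  have "coeff (pcompose (lift a) [:?t, 1:]) j =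
      (\<Sum>n\<le>degree a. scalar (coeff a n) * coeff ([:?t, 1:] ^ n) j)"
    by (simp add: pcompose_altdef poly_altdef degree_map_poly coeff_map_poly degree_lift
        coeff_lift coeff_sum)
  also have "\<dots> = (\<Sum>n\<le>degree a. scalar (of_nat (n choose j) * coeff a n) * ?t ^ (n - j))"
  proof (intro sum.cong refl)
    fix n
    have "coeff ([:?t, 1:] ^ n) j = of_nat (n choose j) * ?t ^ (n - j)"
    proof (cases "j \<le> n")
      case True
      then show ?thesis
        by (simp add: coeff_linear_poly_power)
    next
      case False
      then show ?thesis
        by (simp add: coeff_eq_0 degree_power_eq binomial_eq_0)
    qed
    then show "scalar (coeff a n) * coeff ([:?t, 1:] ^ n) j =
        scalar (of_nat (n choose j) * coeff a n) * ?t ^ (n - j)"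
      by (simp add: scalar_mult scalar_of_nat)
  qed
  also have "\<dots> = poly (lift (hyperderiv j a)) ?t"
    by (simp add: hyperderiv_def lift_sum lift_monom poly_sum poly_monom)
  finally show ?thesis
    by (simp add: poly_lift_theta_conj)
qed

section \<open>The sum of the inverses of the monic polynomials\<close>

text \<open>
  This is the logarithmic derivative of the product at \<open>0\<close>.
\<close>
lemma coeff_prod_linear_0_1:
  fixes x :: "'k \<Rightarrow> 'b::field"
  assumes "finite S" "\<And>k. k \<in> S \<Longrightarrow> x k \<noteq> 0"
  shows "coeff (\<Prod>k\<in>S. [:- x k, 1:]) 1 = - coeff (\<Prod>k\<in>S. [:- x k, 1:]) 0 * (\<Sum>k\<in>S. 1 / x k)"
  using assms
  by (induction S rule: finite_induct) (simp_all add: field_simps)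

text \<open>
  Comparing leading coefficients in the Lagrange interpolation of \<open>a(t)\<close> at \<open>i + 1\<close> conjugates of
  \<open>\<theta>\<close> gives a polynomial \<open>E\<close> of degree \<open>q\<^sup>i\<close>, involving only \<open>q\<close>-power exponents, which takes the value
  \<open>1\<close> at every monic \<open>a\<close> of degree \<open>i\<close>: the Carlitz polynomial \<open>e\<^sub>i / D\<^sub>i\<close>. There are \<open>q\<^sup>i\<close> such \<open>a\<close>, so
  they are all the roots of \<open>E - 1\<close>, and the sum of their inverses is the negative quotient of the
  coefficients of \<open>E - 1\<close> at \<open>X\<close> and \<open>1\<close>. These are \<open>1 / L\<^sub>i\<close> and \<open>- 1\<close>.
\<close>
lemma sum_inverse_monic:
  fixes i :: nat
  shows "(\<Sum>a\<in>(monic_polys i :: 'a::{field, finite} poly set). 1 / to_fract a) =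
    1 / to_fract (carlitz_L (CARD('a)) i)"
proof -
  let ?q = "CARD('a)" and ?A = "monic_polys i :: 'a poly set"
  let ?T = "theta_conj :: nat \<Rightarrow> 'a poly fract"
  have q: "?q > 1"
    by (rule CARD_field_gt_1)
  define d where "d k = (\<Prod>l\<in>{..i} - {k}. ?T k - ?T l)" for k
  have d: "d k \<noteq> 0" for k
    by (simp add: d_def inj_eq [OF inj_theta_conj])
  define E where "E = (\<Sum>k\<le>i. monom (1 / d k) (?q ^ k))"
  have E: "poly E (to_fract a) = 1" if a: "a \<in> ?A" for a
  proof -
    have "lift a = (\<Sum>k\<le>i. smult (poly (lift a) (?T k)) (lagrange_basis {..i} ?T k))"
      using a by (intro lagrange_interpolation)
        (auto simp: degree_lift monic_polys_def intro: inj_on_subset [OF inj_theta_conj])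
    then have "coeff (lift a) i =
        (\<Sum>k\<le>i. poly (lift a) (?T k) * coeff (lagrange_basis {..i} ?T k) i)"
      by (metis (no_types, lifting) coeff_sum coeff_smult sum.cong)
    also have "\<dots> = (\<Sum>k\<le>i. to_fract a ^ (?q ^ k) * (1 / d k))"
    proof (intro sum.cong refl)
      fix k
      assume "k \<in> {..i}"
      then have "card ({..i} - {k}) = i"
        by (simp add: card_Diff_singleton)
      then show "poly (lift a) (?T k) * coeff (lagrange_basis {..i} ?T k) i =
          to_fract a ^ (?q ^ k) * (1 / d k)"
        using coeff_prod_linear [of ?T "{..i} - {k}"]
        by (simp add: lagrange_basis_def poly_lift_theta_conj d_def)
    qed
    finally have "(\<Sum>k\<le>i. to_fract a ^ (?q ^ k) * (1 / d k)) = coeff (lift a) i"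
      by simp
    also have "\<dots> = 1"
      using a by (auto simp: coeff_lift monic_polys_def)
    finally show ?thesis
      by (simp add: E_def poly_sum poly_monom)
  qed
  have coeff_E: "coeff E n = (\<Sum>k\<le>i. if ?q ^ k = n then 1 / d k else 0)" for n
    by (simp add: E_def coeff_sum)
  have q_inj: "?q ^ k = ?q ^ l \<longleftrightarrow> k = l" for k l
    using q by simp
  define G where "G = (\<Prod>a\<in>?A. [:- to_fract a, 1:])"
  have nz: "to_fract a \<noteq> 0" if "a \<in> ?A" for a
    using that by (auto simp: monic_polys_def)
  have "E - 1 = smult (1 / d i) G"
  proof (rule poly_eqI_degree_lead_coeff [where n = "?q ^ i" and A = "to_fract ` ?A"])
    show "coeff (E - 1) (?q ^ i) = coeff (smult (1 / d i) G) (?q ^ i)"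
      using coeff_prod_linear [of to_fract ?A] q
      by (simp add: coeff_E q_inj G_def card_monic_polys)
    show "card (to_fract ` ?A) \<ge> ?q ^ i"
      by (subst card_image) (simp_all add: card_monic_polys inj_on_def)
    have "degree E \<le> ?q ^ i"
      unfolding E_def using q
      by (intro degree_sum_le order.trans [OF degree_monom_le] power_increasing) auto
    then show "degree (E - 1) \<le> ?q ^ i"
      by (intro degree_diff_le) auto
    show "degree (smult (1 / d i) G) \<le> ?q ^ i"
      using degree_prod_linear [of to_fract ?A] d by (simp add: G_def card_monic_polys)
    show "poly (E - 1) z = poly (smult (1 / d i) G) z" if "z \<in> to_fract ` ?A" for z
      using that by (auto simp: E G_def poly_prod finite_monic_polys)
  qed
  then have "coeff (E - 1) 0 = 1 / d i * coeff G 0" "coeff (E - 1) 1 = 1 / d i * coeff G 1"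
    by simp_all
  moreover have "coeff (E - 1) 0 = -1"
    using q by (simp add: coeff_E)
  moreover have "coeff (E - 1) 1 = 1 / d 0"
    using q_inj [of _ 0] by (simp add: coeff_E)
  moreover have "coeff G 1 = - coeff G 0 * (\<Sum>a\<in>?A. 1 / to_fract a)"
    unfolding G_def using nz by (intro coeff_prod_linear_0_1 finite_monic_polys)
  ultimately have "coeff G 0 = - d i"
    and "1 / d 0 = 1 / d i * (- coeff G 0 * (\<Sum>a\<in>?A. 1 / to_fract a))"
    using d [of i] by (simp_all add: field_simps eq_neg_iff_add_eq_0)
  then have "(\<Sum>a\<in>?A. 1 / to_fract a) = 1 / d 0"
    using d [of i] by simp
  moreover have "{..i} - {0} = {1..i}"
    by auto
  ultimately show ?thesis
    by (simp add: d_def carlitz_L_def theta_conj_def to_fract_prod)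
qed

section \<open>The sum with hyperderivatives\<close>

text \<open>
  The elementary symmetric polynomials are coefficients of a product of factors \<open>1 + x t\<close>; reversing
  the coefficients turns each factor \<open>t - x\<close> into \<open>1 - x t\<close>, also when \<open>x = 0\<close>. This case does occur
  below: one of the values \<open>\<theta>\<^sub>k - \<theta>\<^sub>\<mu>\<close> vanishes if \<open>\<mu> < i\<close>.
\<close>
lemma coeff_prod_linear_eq_elem_sym:
  fixes x :: "nat \<Rightarrow> 'b::field"
  assumes "j \<le> i"
  shows "coeff (\<Prod>k<i. [:- x k, 1:]) j = (-1) ^ (i - j) * elem_sym i (i - j) x"
proof -
  have "coeff (\<Prod>k<i. [:- x k, 1:]) j = coeff (reflect_poly (\<Prod>k<i. [:- x k, 1:])) (i - j)"
    using assms by (simp add: coeff_reflect_poly degree_prod_linear)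
  also have "reflect_poly (\<Prod>k<i. [:- x k, 1:]) = (\<Prod>k<i. [:1, - x k:])"
    by (subst reflect_poly_prod) (simp add: reflect_poly_def)
  also have "\<dots> = pcompose (\<Prod>k<i. [:1, x k:]) [:0, -1:]"
    by (simp add: pcompose_prod pcompose_pCons)
  finally show ?thesis
    by (simp add: coeff_pcompose_linear elem_sym_def)
qed

text \<open>
  The polynomial \<open>a(t) - B(t)\<close> has degree less than \<open>i\<close>, and \<open>B\<close> vanishes at the nodes. So its
  Lagrange interpolation involves \<open>a\<close> only through the values \<open>a(\<theta>\<^sub>k)\<close>, the Frobenius powers of \<open>a\<close>.
\<close>
lemma hyperderiv_power_monic:
  fixes j i \<mu> :: nat
  assumes "j \<le> i"
  obtains g where "\<And>a :: 'a::{field, finite} poly. a \<in> monic_polys i \<Longrightarrow>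
    to_fract (hyperderiv j a ^ (CARD('a) ^ \<mu>)) =
      to_fract ((-1) ^ (i - j) *
        elem_sym i (i - j) (\<lambda>k. \<theta> ^ (CARD('a) ^ k) - \<theta> ^ (CARD('a) ^ \<mu>))) +
      (\<Sum>k<i. g k * to_fract a ^ (CARD('a) ^ k))"
proof -
  let ?q = "CARD('a)"
  let ?T = "theta_conj :: nat \<Rightarrow> 'a poly fract"
  let ?x = "\<lambda>k. \<theta> ^ (?q ^ k) - \<theta> ^ (?q ^ \<mu>) :: 'a poly"
  let ?shift = "\<lambda>p. pcompose p [:?T \<mu>, 1:]"
  define B where "B = (\<Prod>k<i. [:- ?T k, 1:])"
  define g where "g k = coeff (?shift (lagrange_basis {..<i} ?T k)) j" for k
  have to_fract_elem_sym: "to_fract (elem_sym i m y) = elem_sym i m (\<lambda>k. to_fract (y k))"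
    for m and y :: "nat \<Rightarrow> 'a poly"
  proof -
    have "map_poly to_fract (\<Prod>k<n. [:1, y k:]) = (\<Prod>k<n. [:1, to_fract (y k):])" for n
    proof (induction n)
      case (Suc n)
      then show ?case
        by (simp add: map_poly_pCons)
    qed simp
    then show ?thesis
      unfolding elem_sym_def by (metis coeff_map_poly to_fract_0)
  qed
  have "?shift B = (\<Prod>k<i. [:- to_fract (?x k), 1:])"
    by (simp add: B_def pcompose_prod pcompose_pCons theta_conj_def)
  then have B: "coeff (?shift B) j = to_fract ((-1) ^ (i - j) * elem_sym i (i - j) ?x)"
    using coeff_prod_linear_eq_elem_sym [OF assms, of "\<lambda>k. to_fract (?x k)"]
    by (simp add: to_fract_elem_sym to_fract_power)
  have "to_fract (hyperderiv j a ^ (?q ^ \<mu>)) =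
      to_fract ((-1) ^ (i - j) * elem_sym i (i - j) ?x) + (\<Sum>k<i. g k * to_fract a ^ (?q ^ k))"
    if a: "a \<in> monic_polys i" for a
  proof -
    have "lift a - B = (\<Sum>k<i. smult (poly (lift a - B) (?T k)) (lagrange_basis {..<i} ?T k))"
    proof (cases "i = 0")
      case True
      then have "a = 1"
        using a by (auto simp: monic_polys_def elim!: degree_eq_zeroE simp: one_pCons)
      with True show ?thesis
        by (simp add: B_def lift_def)
    next
      case False
      have "degree (lift a - B) < i"
      proof -
        have "degree B = i" "coeff B i = 1"
          using degree_prod_linear [of ?T "{..<i}"] coeff_prod_linear [of ?T "{..<i}"]
          by (simp_all add: B_def)
        moreover have "degree (lift a) = i" "coeff (lift a) i = 1"
          using a by (auto simp: degree_lift coeff_lift monic_polys_def)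
        ultimately show ?thesis
          using False by (intro degree_lessI) (auto simp: coeff_eq_0 le_less)
      qed
      then show ?thesis
        by (intro lagrange_interpolation) (auto intro: inj_on_subset [OF inj_theta_conj])
    qed
    also have "\<dots> = (\<Sum>k<i. smult (to_fract a ^ (?q ^ k)) (lagrange_basis {..<i} ?T k))"
    proof (intro sum.cong refl)
      fix k
      assume "k \<in> {..<i}"
      then have "poly B (?T k) = 0"
        by (auto simp: B_def poly_prod)
      then show "smult (poly (lift a - B) (?T k)) (lagrange_basis {..<i} ?T k) =
          smult (to_fract a ^ (?q ^ k)) (lagrange_basis {..<i} ?T k)"
        by (simp add: poly_lift_theta_conj)
    qed
    finally have "lift a = B + (\<Sum>k<i. smult (to_fract a ^ (?q ^ k)) (lagrange_basis {..<i} ?T k))"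
      by (simp add: algebra_simps)
    then have "coeff (?shift (lift a)) j =
        coeff (?shift B) j + (\<Sum>k<i. g k * to_fract a ^ (?q ^ k))"
      by (simp add: pcompose_add pcompose_sum pcompose_smult coeff_sum g_def mult.commute)
    then show ?thesis
      by (simp add: to_fract_power hyperderiv_power_eq_coeff B)
  qed
  then show thesis
    by (rule that)
qed

theorem theorem5p5:
  fixes q i s :: nat and \<mu> j :: "nat \<Rightarrow> nat"
  assumes "q = CARD('a::{field, finite})"
    and "i \<ge> 1"
    and "1 \<le> s" and "s \<le> q - 1"
    and "\<forall>r\<in>{1..s}. j r \<le> i"
  shows "(\<Sum>a\<in>(monic_polys i :: 'a poly set).
            to_fract (\<Prod>r=1..s. hyperderiv (j r) a ^ (q ^ \<mu> r)) / to_fract a) =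
         1 / to_fract (carlitz_L q i :: 'a poly) *
         to_fract (\<Prod>r=1..s. (-1) ^ (i - j r) *
           elem_sym i (i - j r) (\<lambda>k. \<theta> ^ (q ^ k) - \<theta> ^ (q ^ \<mu> r)))"
proof -
  let ?A = "monic_polys i :: 'a poly set" and ?R = "{1..s}"
  define b :: "nat \<Rightarrow> 'a poly" where "b r = (-1) ^ (i - j r) *
    elem_sym i (i - j r) (\<lambda>k. \<theta> ^ (q ^ k) - \<theta> ^ (q ^ \<mu> r))" for r
  have "\<forall>r\<in>?R. \<exists>g. \<forall>a\<in>?A. to_fract (hyperderiv (j r) a ^ (q ^ \<mu> r)) =
      to_fract (b r) + (\<Sum>k<i. g k * to_fract a ^ (q ^ k))"
  proof
    fix r
    assume "r \<in> ?R"
    then have "j r \<le> i"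
      using assms by blast
    then show "\<exists>g. \<forall>a\<in>?A. to_fract (hyperderiv (j r) a ^ (q ^ \<mu> r)) =
        to_fract (b r) + (\<Sum>k<i. g k * to_fract a ^ (q ^ k))"
      unfolding b_def assms(1) by (rule hyperderiv_power_monic) blast
  qed
  then obtain g where g: "to_fract (hyperderiv (j r) a ^ (q ^ \<mu> r)) =
      to_fract (b r) + (\<Sum>k<i. g r k * to_fract a ^ (q ^ k))" if "r \<in> ?R" "a \<in> ?A" for r a
    by metis
  define F where "F r a = (\<Sum>k<i. g r k * to_fract a ^ (q ^ k))" for r a
  have F: "(\<Sum>a\<in>?A. (\<Prod>r\<in>Y. F r a) / to_fract a) = 0" if "Y \<subseteq> ?R" "Y \<noteq> {}" for Y
  proof -
    have "card Y \<le> card ?R"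
      using that by (intro card_mono) auto
    then show ?thesis
      unfolding F_def assms(1) using that assms
      by (intro sum_monic_prod_linearized_div_eq_0) (auto intro: finite_subset)
  qed
  have "(\<Sum>a\<in>?A. to_fract (\<Prod>r\<in>?R. hyperderiv (j r) a ^ (q ^ \<mu> r)) / to_fract a) =
      (\<Sum>a\<in>?A. (\<Prod>r\<in>?R. to_fract (b r) + F r a) / to_fract a)"
    by (intro sum.cong refl arg_cong2 [where f = "(/)"]) (simp add: to_fract_prod g F_def)
  also have "\<dots> = (\<Sum>a\<in>?A. \<Sum>X\<in>Pow ?R.
      (\<Prod>r\<in>X. to_fract (b r)) * ((\<Prod>r\<in>?R - X. F r a) / to_fract a))"
    by (simp add: prod_add sum_divide_distrib)
  also have "\<dots> = (\<Sum>X\<in>Pow ?R. \<Sum>a\<in>?A.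
      (\<Prod>r\<in>X. to_fract (b r)) * ((\<Prod>r\<in>?R - X. F r a) / to_fract a))"
    by (rule sum.swap)
  also have "\<dots> = (\<Sum>X\<in>Pow ?R.
      (\<Prod>r\<in>X. to_fract (b r)) * (\<Sum>a\<in>?A. (\<Prod>r\<in>?R - X. F r a) / to_fract a))"
    by (simp only: sum_distrib_left)
  also have "\<dots> = (\<Sum>X\<in>{?R}.
      (\<Prod>r\<in>X. to_fract (b r)) * (\<Sum>a\<in>?A. (\<Prod>r\<in>?R - X. F r a) / to_fract a))"
  proof (intro sum.mono_neutral_right ballI)
    fix X
    assume "X \<in> Pow ?R - {?R}"
    then have "(\<Sum>a\<in>?A. (\<Prod>r\<in>?R - X. F r a) / to_fract a) = 0"
      by (intro F) auto
    then show "(\<Prod>r\<in>X. to_fract (b r)) * (\<Sum>a\<in>?A. (\<Prod>r\<in>?R - X. F r a) / to_fract a) = 0"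
      by simp
  qed auto
  also have "\<dots> = 1 / to_fract (carlitz_L q i) * to_fract (\<Prod>r\<in>?R. b r)"
    by (simp add: sum_inverse_monic assms(1) to_fract_prod)
  finally show ?thesis
    by (simp add: b_def)
qed

end
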